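(* Let $\mu>-1/2$, $\varepsilon\in\{0,1\}$, and let $n\ge0$ be an integer. The polynomial factors (in $s$) of the Mellin transforms $M_{2n+\varepsilon}^\mu(s)$ given in the context are proportional to the Meixner-Pollaczek polynomials $$P_n^{(\mu+\varepsilon)/2+1/4}\left(i\left(\tfrac14-\tfrac s2\right);\tfrac{\pi}{2}\right)=\frac{(\mu+\frac12+\varepsilon)_n}{n!}\,i^n\,{}_2F_1\left(-n,\tfrac{\mu+s+\varepsilon}{2};\mu+\tfrac12+\varepsilon;2\right).$$
   Context: The Meixner-Pollaczek polynomials are $$P_n^\lambda(x;\phi)=\frac{(2\lambda)_n}{n!}e^{in\phi}\,{}_2F_1\left(-n,\lambda+ix;2\lambda;1-e^{-2i\phi}\right),\qquad \lambda>0,\ 0<\phi<\pi,$$ where $(a)_n=a(a+1)\cdots(a+n-1)$ is the Pochhammer symbol and ${}_2F_1(-n,b;c;z)=\sum_{j=0}^n \frac{(-n)_j(b)_j}{(c)_j}\frac{z^j}{j!}$. Generalized Hermite polynomials, for $\mu>-1/2$: $H_{2n}^\mu(x)=(-1)^n2^{2n}n!\,L_n^{\mu-1/2}(x^2)$ and $H_{2n+1}^\mu(x)=(-1)^n2^{2n+1}n!\,x\,L_n^{\mu+1/2}(x^2)$, where $L_n^\alpha(x)=\binom{n+\alpha}{n}\,{}_1F_1(-n;\alpha+1;x)$ are the Laguerre polynomials. For $\operatorname{Re}s>0$ their Mellin transforms are $M_n^\mu(s)=\int_0^\infty x^{s-1}H_n^\mu(x)x^\mu e^{-x^2/2}\,dx$,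 given by $$M_{2n}^\mu(s)=(-1)^n2^{2n}2^{(\mu+s)/2-1}\left(\mu+\tfrac12\right)_n\Gamma\left(\tfrac{\mu+s}{2}\right)\,{}_2F_1\left(-n,\tfrac{\mu+s}{2};\mu+\tfrac12;2\right),$$ $$M_{2n+1}^\mu(s)=(-1)^n2^{2n}2^{(\mu+s+1)/2}\left(\mu+\tfrac32\right)_n\Gamma\left(\tfrac{\mu+s+1}{2}\right)\,{}_2F_1\left(-n,\tfrac{\mu+s+1}{2};\mu+\tfrac32;2\right);$$ the polynomial factors referred to are the ones in these formulas. *)

theory Defs
  imports "HOL-Analysis.Analysis" "HOL-Computational_Algebra.Polynomial"
begin

(* Terminating series 1F1(-n; c; x) and 2F1(-n, b; c; z), with the numerator parameter -n
   supplied through the natural number n. *)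
definition hyp1F1_term :: "nat \<Rightarrow> real \<Rightarrow> real \<Rightarrow> real" where
  "hyp1F1_term n c x =
     (\<Sum>j\<le>n. pochhammer (- real n) j / pochhammer c j * (x ^ j / fact j))"

definition hyp2F1_term :: "nat \<Rightarrow> complex \<Rightarrow> complex \<Rightarrow> complex \<Rightarrow> complex" where
  "hyp2F1_term n b c z =
     (\<Sum>j\<le>n. pochhammer (- of_nat n) j * pochhammer b j / pochhammer c j * (z ^ j / fact j))"

(* The parameters satisfy lambda > 0 and 0 < phi < pi; the argument x may be complex. *)
definition meixner_pollaczek :: "nat \<Rightarrow> real \<Rightarrow> complex \<Rightarrow> real \<Rightarrow> complex" where
  "meixner_pollaczek n lam x \<phi> =
     of_real (pochhammer (2 * lam) n / fact n) * exp (\<i> * of_nat n * of_real \<phi>) *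
     hyp2F1_term n (of_real lam + \<i> * x) (of_real (2 * lam)) (1 - exp (- 2 * \<i> * of_real \<phi>))"

definition laguerre :: "nat \<Rightarrow> real \<Rightarrow> real \<Rightarrow> real" where
  "laguerre n \<alpha> x = ((real n + \<alpha>) gchoose n) * hyp1F1_term n (\<alpha> + 1) x"

definition gen_hermite :: "real \<Rightarrow> nat \<Rightarrow> real \<Rightarrow> real" where
  "gen_hermite \<mu> m x =
     (let n = m div 2 in
      if even m then (-1) ^ n * 2 ^ (2 * n) * fact n * laguerre n (\<mu> - 1/2) (x\<^sup>2)
      else (-1) ^ n * 2 ^ (2 * n + 1) * fact n * x * laguerre n (\<mu> + 1/2) (x\<^sup>2))"

definition hermite_mellin_integrand :: "real \<Rightarrow> nat \<Rightarrow> complex \<Rightarrow> real \<Rightarrow> complex" where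
  "hermite_mellin_integrand \<mu> m s x =
     of_real x powr (s - 1) * of_real (gen_hermite \<mu> m x * x powr \<mu> * exp (- x\<^sup>2 / 2))"

definition hermite_mellin :: "real \<Rightarrow> nat \<Rightarrow> complex \<Rightarrow> complex" where
  "hermite_mellin \<mu> m s = (LINT x:{0<..}|lborel. hermite_mellin_integrand \<mu> m s x)"

(* The polynomial factor in s of the Mellin transform of index 2n + eps, without its constant
   (-1)^n 2^(2n) (mu + 1/2 + eps)_n; here eps is 0 or 1. *)
definition mellin_poly_factor :: "real \<Rightarrow> nat \<Rightarrow> nat \<Rightarrow> complex \<Rightarrow> complex" where
  "mellin_poly_factor \<mu> \<epsilon> n s =
     hyp2F1_term n ((of_real \<mu> + s + of_nat \<epsilon>) / 2) (of_real \<mu> + 1/2 + of_nat \<epsilon>) 2"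

end

(* Substituting t = x^2/2 in Euler's integral for Gamma evaluates the Mellin transform of
   exp(-x^2/2). Expanding the Laguerre polynomial in powers of x^2 shifts the Mellin variable by 2j,
   i.e. the Gamma argument by j, and Gamma (b + j) / Gamma b = (b)_j turns the 1F1 into a 2F1 at 2. *)
theory Submission
  imports Defs
begin

text \<open>With t = \<open>x\<^sup>2 / 2\<close> and dt = x dx, the form x^(w-1) dx becomes
  2^(w/2-1) t^(w/2-1) dt, which leaves Euler's integral at w/2. Integrability is recorded together
  with the value because the later exchange of sum and integral depends on it.\<close>

lemma gaussian_mellin:
  fixes w :: complex
  assumes w: "Re w > 0"
  defines "f \<equiv> \<lambda>x::real. of_real x powr (w - 1) * of_real (exp (- x\<^sup>2 / 2))"
  shows set_integrable_gaussian_mellin: "set_integrable lborel {0<..} f" (is ?int)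
    and set_integral_gaussian_mellin:
      "(LINT x:{0<..}|lborel. f x) = 2 powr (w / 2 - 1) * Gamma (w / 2)" (is "_ = ?I")
proof -
  define g :: "real \<Rightarrow> real" where "g = (\<lambda>x. x\<^sup>2 / 2)"
  define h where "h = (\<lambda>t. complex_of_real t powr (w / 2 - 1) / of_real (exp t))"
  have img: "g ` {0<..} = {0<..}"
  proof
    show "{0<..} \<subseteq> g ` {0<..}"
    proof
      fix t :: real assume "t \<in> {0<..}"
      then have "t = g (sqrt (2 * t))" "sqrt (2 * t) \<in> {0<..}"
        by (auto simp: g_def)
      then show "t \<in> g ` {0<..}" by blast
    qed
  qed (auto simp: g_def)
  have inj: "inj_on g {0<..}"
    by (auto simp: g_def inj_on_def)
  have deriv: "(g has_field_derivative x) (at x within {0<..})" for x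
    unfolding g_def by (auto intro!: derivative_eq_intros)
  have "Re (w / 2) > 0" using w by simp
  note gamma = absolutely_integrable_Gamma_integral'[OF this] Gamma_integral_complex'[OF this]
  \<comment> \<open>The factor \<open>\<bar>x\<bar>\<close> is the Jacobian of \<open>g\<close>,
    whose derivative at x is x. The change of variables transfers integrability and value in one
    step.\<close>
  have subst: "(\<lambda>x. \<bar>x\<bar> *\<^sub>R h (g x)) absolutely_integrable_on {0<..} \<and>
      integral {0<..} (\<lambda>x. \<bar>x\<bar> *\<^sub>R h (g x)) = Gamma (w / 2)"
    using has_absolute_integral_change_of_variables_real[of "{0<..}" g "\<lambda>x. x" h "Gamma (w / 2)"]
      gamma img inj deriv
    by (auto simp: h_def integral_unique)
  \<comment> \<open>All bases are positive reals, so their complex logarithms are real. Every power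
    is written as an exponential in \<open>ln x\<close> and \<open>ln 2\<close>, and the exponents
    are compared.\<close>
  have eq: "2 powr (w / 2 - 1) * (\<bar>x\<bar> *\<^sub>R h (g x)) = f x" if "x \<in> {0<..}" for x
  proof -
    have x: "x > 0" using that by simp
    have "Ln (of_real (g x)) = of_real (2 * ln x - ln 2)"
      using x by (simp add: g_def Ln_of_real ln_div ln_realpow del: of_real_divide of_real_power)
    then have "of_real (g x) powr (w / 2 - 1) = exp ((w / 2 - 1) * of_real (2 * ln x - ln 2))"
      using x by (simp add: powr_def g_def)
    moreover have "2 powr (w / 2 - 1) = exp ((w / 2 - 1) * of_real (ln 2))"
      using Ln_of_real[of 2] by (simp add: powr_def)
    moreover have "complex_of_real x powr (w - 1) = exp ((w - 1) * of_real (ln x))"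
      using x by (simp add: powr_def Ln_of_real)
    moreover have "complex_of_real x = exp (of_real (ln x))"
      using x by (simp add: exp_of_real)
    ultimately have "2 powr (w / 2 - 1) * (of_real x * of_real (g x) powr (w / 2 - 1)) =
        of_real x powr (w - 1)"
      by (simp add: algebra_simps flip: exp_add)
    then show ?thesis
      using x by (simp add: f_def h_def g_def scaleR_conv_of_real exp_minus field_simps)
  qed
  have "(\<lambda>x. 2 powr (w / 2 - 1) * (\<bar>x\<bar> *\<^sub>R h (g x))) absolutely_integrable_on {0<..}"
    using subst by (intro set_integrable_mult_right) auto
  then have abs: "f absolutely_integrable_on {0<..}"
    using eq by (subst (asm) set_integrable_cong[OF refl refl eq]) auto
  \<comment> \<open>So far \<open>f\<close> is integrable only for the completed Lebesgue measure.
    Borel measurability, obtained from continuity, brings the result down to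
    \<open>lborel\<close>.\<close>
  have "continuous_on {0<..} f"
    unfolding f_def by (intro continuous_intros) auto
  then have "set_borel_measurable borel {0<..} f"
    by (intro borel_measurable_continuous_on_indicator[folded set_borel_measurable_def]) auto
  then show int: ?int
    using abs by (simp add: set_integrable_def set_borel_measurable_def integrable_completion)
  have "(LINT x:{0<..}|lborel. f x) = integral {0<..} f"
    using set_borel_integral_eq_integral(2)[OF int] .
  also have "\<dots> = integral {0<..} (\<lambda>x. 2 powr (w / 2 - 1) * (\<bar>x\<bar> *\<^sub>R h (g x)))"
    using eq by (intro integral_cong) auto
  also have "\<dots> = ?I"
    using subst by (simp del: mult_scaleR_right)
  finally show "(LINT x:{0<..}|lborel. f x) = ?I" .
qed

lemma set_integral_sum:
  fixes f :: "'i \<Rightarrow> 'a \<Rightarrow> 'b :: {banach, second_countable_topology}"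
  assumes "\<And>i. i \<in> I \<Longrightarrow> set_integrable M A (f i)"
  shows set_integrable_sum: "set_integrable M A (\<lambda>x. \<Sum>i\<in>I. f i x)"
    and "(LINT x:A|M. (\<Sum>i\<in>I. f i x)) = (\<Sum>i\<in>I. LINT x:A|M. f i x)"
  using assms
  by (simp_all add: set_integrable_def set_lebesgue_integral_def scaleR_sum_right)

text \<open>With \<alpha> = \<mu> - 1/2 + \<epsilon>, the product of n! and the binomial coefficient
  in the Laguerre polynomial is (\<alpha> + 1)_n. This puts both parities into one formula, so that
  the Mellin transform is computed only once.\<close>

lemma gen_hermite_conv_hyp1F1:
  assumes "\<epsilon> \<in> {0, 1}"
  shows "gen_hermite \<mu> (2 * n + \<epsilon>) x =
    (-1) ^ n * 2 ^ (2 * n + \<epsilon>) * pochhammer (\<mu> + 1/2 + real \<epsilon>) n * x ^ \<epsilon> *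
    hyp1F1_term n (\<mu> + 1/2 + real \<epsilon>) (x\<^sup>2)"
proof -
  have "fact n * ((real n + \<alpha>) gchoose n) = pochhammer (\<alpha> + 1) n" for \<alpha> :: real
    by (simp add: gbinomial_pochhammer')
  then have L: "fact n * laguerre n \<alpha> y = pochhammer (\<alpha> + 1) n * hyp1F1_term n (\<alpha> + 1) y"
    for \<alpha> y :: real
    by (simp add: laguerre_def flip: mult.assoc)
  from assms consider "\<epsilon> = 0" | "\<epsilon> = 1" by auto
  then show ?thesis
  proof cases
    case 1
    then show ?thesis
      using L[of "\<mu> - 1/2" "x\<^sup>2"] by (simp add: gen_hermite_def algebra_simps)
  next
    case 2
    then show ?thesis
      using L[of "\<mu> + 1/2" "x\<^sup>2"] by (simp add: gen_hermite_def algebra_simps)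
  qed
qed

text \<open>The weight x^\<mu> and the odd factor x^\<epsilon> join s in the single Mellin variable
  \<open>w\<close>. The monomial x^(2j) moves it to w + 2j, so Re w > 0 makes every term
  converge.\<close>

lemma hermite_mellin_eq:
  fixes \<mu> :: real and \<epsilon> n :: nat and s :: complex
  assumes \<epsilon>: "\<epsilon> \<in> {0, 1}" and s: "Re s + \<mu> + real \<epsilon> > 0"
  defines "w \<equiv> of_real \<mu> + s + of_nat \<epsilon>"
  shows set_integrable_hermite_mellin_integrand:
      "set_integrable lborel {0<..} (hermite_mellin_integrand \<mu> (2 * n + \<epsilon>) s)"
    and hermite_mellin_conv_mellin_poly_factor:
      "hermite_mellin \<mu> (2 * n + \<epsilon>) s =
         (-1) ^ n * 2 ^ (2 * n + \<epsilon>) * pochhammer (of_real \<mu> + 1/2 + of_nat \<epsilon>) n *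
         (2 powr (w / 2 - 1) * Gamma (w / 2) * mellin_poly_factor \<mu> \<epsilon> n s)"
proof -
  define c where "c = \<mu> + 1/2 + real \<epsilon>"
  define K where "K = (-1) ^ n * 2 ^ (2 * n + \<epsilon>) * pochhammer c n"
  \<comment> \<open>The 1F1 and the 2F1 share these coefficients, so they pass through the integral
    unchanged.\<close>
  define a where "a j = pochhammer (- real n) j / pochhammer c j / fact j" for j
  define G where "G j x = of_real x powr (w + of_nat (2 * j) - 1) * of_real (exp (- x\<^sup>2 / 2))"
    for j and x :: real
  have w: "Re w > 0" using s by (simp add: w_def algebra_simps)
  then have wj: "Re (w + of_nat (2 * j)) > 0" for j by simp
  have pw: "complex_of_real x powr (s - 1) * of_real (x powr \<mu> * x ^ \<epsilon> * (x\<^sup>2) ^ j) =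
      of_real x powr (w + of_nat (2 * j) - 1)" if "x > 0" for x j
  proof -
    have "complex_of_real x powr (w + of_nat (2 * j) - 1) =
        of_real x powr ((s - 1) + of_real \<mu> + of_nat (\<epsilon> + 2 * j))"
      by (simp add: w_def algebra_simps)
    also have "\<dots> = of_real x powr (s - 1) * of_real x powr of_real \<mu> * of_real x ^ (\<epsilon> + 2 * j)"
      using that powr_nat'[of "complex_of_real x" "\<epsilon> + 2 * j"] by (simp only: powr_add) simp
    also have "complex_of_real x powr of_real \<mu> = of_real (x powr \<mu>)"
      using that by (simp add: powr_of_real)
    finally show ?thesis
      by (simp add: power_add power_mult)
  qed
  have eq: "hermite_mellin_integrand \<mu> (2 * n + \<epsilon>) s x = of_real K * (\<Sum>j\<le>n. of_real (a j) * G j x)"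
    if x: "x > 0" for x
  proof -
    have "hermite_mellin_integrand \<mu> (2 * n + \<epsilon>) s x = of_real x powr (s - 1) * 
        of_real (K * (\<Sum>j\<le>n. a j * (x powr \<mu> * x ^ \<epsilon> * (x\<^sup>2) ^ j)) * exp (- x\<^sup>2 / 2))"
      unfolding hermite_mellin_integrand_def gen_hermite_conv_hyp1F1[OF \<epsilon>] hyp1F1_term_def
      by (simp add: K_def a_def c_def sum_distrib_left sum_distrib_right mult_ac)
    also have "\<dots> = of_real K * (\<Sum>j\<le>n. of_real (a j) *
        (of_real x powr (s - 1) * of_real (x powr \<mu> * x ^ \<epsilon> * (x\<^sup>2) ^ j)) * of_real (exp (- x\<^sup>2 / 2)))"
      by (simp add: sum_distrib_left sum_distrib_right mult_ac)
    also have "\<dots> = of_real K * (\<Sum>j\<le>n. of_real (a j) * G j x)"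
      unfolding pw[OF x] G_def by (simp add: mult.assoc)
    finally show ?thesis .
  qed
  have G: "set_integrable lborel {0<..} (G j)"
    "(LINT x:{0<..}|lborel. G j x) = 2 powr (w / 2 - 1) * Gamma (w / 2) * (2 ^ j * pochhammer (w / 2) j)"
    for j
  proof -
    show "set_integrable lborel {0<..} (G j)"
      unfolding G_def using set_integrable_gaussian_mellin[OF wj] .
    have arg: "(w + of_nat (2 * j)) / 2 = w / 2 + of_nat j" by (simp add: field_simps)
    \<comment> \<open>Away from the poles \<open>Gamma (w / 2)\<close> is nonzero, so the quotient
      formula for the Pochhammer symbol can be cleared of its denominator.\<close>
    have "w / 2 \<notin> \<int>\<^sub>\<le>\<^sub>0" using w by (auto elim!: nonpos_Ints_cases')
    then have "Gamma (w / 2 + of_nat j) = pochhammer (w / 2) j * Gamma (w / 2)"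
      by (simp add: pochhammer_Gamma Gamma_eq_zero_iff)
    moreover have "(2::complex) powr (w / 2 + of_nat j - 1) = 2 powr (w / 2 - 1) * 2 ^ j"
      using powr_add[of "2::complex" "w / 2 - 1" "of_nat j"] by (simp add: powr_nat' algebra_simps)
    ultimately show "(LINT x:{0<..}|lborel. G j x) =
        2 powr (w / 2 - 1) * Gamma (w / 2) * (2 ^ j * pochhammer (w / 2) j)"
      unfolding G_def set_integral_gaussian_mellin[OF wj] arg by (simp add: mult_ac)
  qed
  have int: "set_integrable lborel {0<..} (\<lambda>x. of_real K * (\<Sum>j\<le>n. of_real (a j) * G j x))"
    by (intro set_integrable_mult_right set_integrable_sum G)
  then show "set_integrable lborel {0<..} (hermite_mellin_integrand \<mu> (2 * n + \<epsilon>) s)"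
    by (subst set_integrable_cong[OF refl refl eq]) auto
  have "hermite_mellin \<mu> (2 * n + \<epsilon>) s =
      (LINT x:{0<..}|lborel. of_real K * (\<Sum>j\<le>n. of_real (a j) * G j x))"
    unfolding hermite_mellin_def by (intro set_lebesgue_integral_cong) (auto simp: eq)
  also have "\<dots> = of_real K * (\<Sum>j\<le>n. of_real (a j) * (LINT x:{0<..}|lborel. G j x))"
    by (simp add: set_integral_sum(2) G)
  also have "\<dots> = of_real K * (2 powr (w / 2 - 1) * Gamma (w / 2) *
      (\<Sum>j\<le>n. of_real (a j) * (2 ^ j * pochhammer (w / 2) j)))"
    by (simp add: G sum_distrib_left mult_ac)
  also have "(\<Sum>j\<le>n. of_real (a j) * (2 ^ j * pochhammer (w / 2) j)) = mellin_poly_factor \<mu> \<epsilon> n s"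
    unfolding mellin_poly_factor_def hyp2F1_term_def
    by (intro sum.cong) (simp_all add: a_def c_def w_def pochhammer_of_real[symmetric])
  also have "complex_of_real K =
      (-1) ^ n * 2 ^ (2 * n + \<epsilon>) * pochhammer (of_real \<mu> + 1/2 + of_nat \<epsilon>) n"
    by (simp add: K_def c_def pochhammer_of_real[symmetric])
  finally show "hermite_mellin \<mu> (2 * n + \<epsilon>) s =
      (-1) ^ n * 2 ^ (2 * n + \<epsilon>) * pochhammer (of_real \<mu> + 1/2 + of_nat \<epsilon>) n *
      (2 powr (w / 2 - 1) * Gamma (w / 2) * mellin_poly_factor \<mu> \<epsilon> n s)" .
qed

text \<open>Evaluation at x is a ring homomorphism; the right-hand Pochhammer symbol is formed in
  the polynomial ring.\<close>

lemma pochhammer_poly: "pochhammer (poly p x) n = poly (pochhammer p n) x"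
  by (induction n) (simp_all add: pochhammer_Suc)

text \<open>Only the second numerator parameter varies with s, so each term is a scalar times a
  Pochhammer polynomial. This yields polynomiality of the Mellin factor.\<close>

lemma hyp2F1_term_poly:
  "hyp2F1_term n (poly p s) c z =
    poly (\<Sum>j\<le>n. smult (pochhammer (- of_nat n) j / pochhammer c j * (z ^ j / fact j)) (pochhammer p j)) s"
  by (simp add: hyp2F1_term_def poly_sum pochhammer_poly mult_ac)

text \<open>At \<phi> = pi/2 the exponential prefactor is i^n and the 2F1 argument is 1 - (-1) = 2.
  The choice of x gives ix = s/2 - 1/4, whose -1/4 cancels the 1/4 in the parameter
  \<lambda>.\<close>

lemma meixner_pollaczek_half_pi:
  fixes \<mu> :: real and \<epsilon> n :: nat and s :: complex
  shows "meixner_pollaczek n ((\<mu> + real \<epsilon>) / 2 + 1/4) (\<i> * (1/4 - s / 2)) (pi / 2) =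
    pochhammer (of_real \<mu> + 1/2 + of_nat \<epsilon>) n / fact n * \<i> ^ n *
    hyp2F1_term n ((of_real \<mu> + s + of_nat \<epsilon>) / 2) (of_real \<mu> + 1/2 + of_nat \<epsilon>) 2"
proof -
  have "exp (\<i> * of_nat n * of_real (pi / 2)) = exp (\<i> * of_real (pi / 2)) ^ n"
    by (simp add: exp_of_nat_mult[symmetric] mult_ac)
  also have "exp (\<i> * of_real (pi / 2)) = \<i>"
    by (simp add: cis_pi_half flip: cis_conv_exp del: of_real_divide)
  finally have e: "exp (\<i> * of_nat n * of_real (pi / 2)) = \<i> ^ n" .
  have z: "1 - exp (- 2 * \<i> * of_real (pi / 2)) = 2"
    by (simp add: exp_minus)
  have b: "of_real ((\<mu> + real \<epsilon>) / 2 + 1/4) + \<i> * (\<i> * (1/4 - s / 2)) =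
      (of_real \<mu> + s + of_nat \<epsilon>) / 2"
    by (simp add: field_simps flip: mult.assoc)
  have c: "complex_of_real (2 * ((\<mu> + real \<epsilon>) / 2 + 1/4)) = of_real \<mu> + 1/2 + of_nat \<epsilon>"
    by (simp add: field_simps)
  show ?thesis
    \<comment> \<open>Restricting the division rule to a \<open>pochhammer\<close> numerator leaves
      the other quotients under \<open>of_real\<close> in the form that \<open>e\<close>,
      \<open>b\<close> and \<open>c\<close> match.\<close>
    unfolding meixner_pollaczek_def e z b c of_real_divide[of "pochhammer _ _"]
      pochhammer_of_real[symmetric] by simp
qed

theorem mainTheorem6:
  fixes \<mu> :: real and \<epsilon> n :: nat
  assumes "\<mu> > - 1/2" and "\<epsilon> \<in> {0, 1}"
  shows
    "(\<forall>s. Re s > 0 \<and> Re s + \<mu> + real \<epsilon> > 0 \<longrightarrow>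
        set_integrable lborel {0<..} (hermite_mellin_integrand \<mu> (2 * n + \<epsilon>) s) \<and>
        (\<epsilon> = 0 \<longrightarrow>
           hermite_mellin \<mu> (2 * n + \<epsilon>) s =
             (-1) ^ n * 2 ^ (2 * n) * 2 powr ((of_real \<mu> + s) / 2 - 1) *
             pochhammer (of_real \<mu> + 1/2) n * Gamma ((of_real \<mu> + s) / 2) *
             mellin_poly_factor \<mu> \<epsilon> n s) \<and>
        (\<epsilon> = 1 \<longrightarrow>
           hermite_mellin \<mu> (2 * n + \<epsilon>) s =
             (-1) ^ n * 2 ^ (2 * n) * 2 powr ((of_real \<mu> + s + 1) / 2) *
             pochhammer (of_real \<mu> + 3/2) n * Gamma ((of_real \<mu> + s + 1) / 2) *
             mellin_poly_factor \<mu> \<epsilon> n s)) \<and>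
     (\<exists>p :: complex poly. \<forall>s. mellin_poly_factor \<mu> \<epsilon> n s = poly p s) \<and>
     (\<exists>c :: complex. c \<noteq> 0 \<and>
        (\<forall>s. mellin_poly_factor \<mu> \<epsilon> n s =
           c * meixner_pollaczek n ((\<mu> + real \<epsilon>) / 2 + 1/4) (\<i> * (1/4 - s / 2)) (pi / 2))) \<and>
     (\<forall>s. meixner_pollaczek n ((\<mu> + real \<epsilon>) / 2 + 1/4) (\<i> * (1/4 - s / 2)) (pi / 2) =
        pochhammer (of_real \<mu> + 1/2 + of_nat \<epsilon>) n / fact n * \<i> ^ n *
        hyp2F1_term n ((of_real \<mu> + s + of_nat \<epsilon>) / 2) (of_real \<mu> + 1/2 + of_nat \<epsilon>) 2)"
proof (intro conjI allI impI)
  fix s :: complex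
  assume "Re s > 0 \<and> Re s + \<mu> + real \<epsilon> > 0"
  then have s: "Re s + \<mu> + real \<epsilon> > 0" by simp
  show "set_integrable lborel {0<..} (hermite_mellin_integrand \<mu> (2 * n + \<epsilon>) s)"
    by (rule set_integrable_hermite_mellin_integrand[OF assms(2) s])
  note mellin = hermite_mellin_conv_mellin_poly_factor[OF assms(2) s, of n]
  show "hermite_mellin \<mu> (2 * n + \<epsilon>) s =
      (-1) ^ n * 2 ^ (2 * n) * 2 powr ((of_real \<mu> + s) / 2 - 1) *
      pochhammer (of_real \<mu> + 1/2) n * Gamma ((of_real \<mu> + s) / 2) * mellin_poly_factor \<mu> \<epsilon> n s"
    if "\<epsilon> = 0"
    using mellin that by (simp add: mult_ac)
  \<comment> \<open>For odd index the surplus 2 in \<open>2 ^ (2 * n + 1)\<close> is absorbed here,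
    raising the exponent w/2 - 1 to w/2.\<close>
  have "2 * 2 powr ((of_real \<mu> + s + 1) / 2 - 1) = (2 powr ((of_real \<mu> + s + 1) / 2) :: complex)"
    by (simp add: powr_diff)
  then have "2 ^ (2 * n + 1) * (2 powr ((of_real \<mu> + s + 1) / 2 - 1) * z) =
      2 ^ (2 * n) * 2 powr ((of_real \<mu> + s + 1) / 2) * z" for z :: complex
    by (simp flip: mult.assoc)
  then show "hermite_mellin \<mu> (2 * n + \<epsilon>) s =
      (-1) ^ n * 2 ^ (2 * n) * 2 powr ((of_real \<mu> + s + 1) / 2) *
      pochhammer (of_real \<mu> + 3/2) n * Gamma ((of_real \<mu> + s + 1) / 2) * mellin_poly_factor \<mu> \<epsilon> n s"
    if "\<epsilon> = 1"
    using mellin that by (simp add: mult_ac add_ac)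
next
  \<comment> \<open>Writing the parameter as a linear polynomial in s lets
    \<open>hyp2F1_term_poly\<close> supply the witness.\<close>
  have arg: "(of_real \<mu> + s + of_nat \<epsilon>) / 2 = poly [:(of_real \<mu> + of_nat \<epsilon>) / 2, 1/2:] s" for s :: complex
    by (simp add: field_simps)
  show "\<exists>p. \<forall>s. mellin_poly_factor \<mu> \<epsilon> n s = poly p s"
    unfolding mellin_poly_factor_def arg hyp2F1_term_poly by blast
next
  have cancel: "z = inverse d * (d * z)" if "d \<noteq> 0" for d z :: complex
    using that by simp
  \<comment> \<open>The proportionality constant is the inverse of this prefactor, which does not
    depend on s. It is nonzero since \<mu> + 1/2 + \<epsilon> > 0 makes the Pochhammer symbol
    positive.\<close>
  let ?d = "pochhammer (of_real \<mu> + 1/2 + of_nat \<epsilon>) n / fact n * \<i> ^ n :: complex"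
  have "pochhammer (\<mu> + 1/2 + real \<epsilon>) n > 0"
    using assms(1) by (intro pochhammer_pos) simp
  moreover have "pochhammer (of_real \<mu> + 1/2 + of_nat \<epsilon>) n =
      complex_of_real (pochhammer (\<mu> + 1/2 + real \<epsilon>) n)"
    by (simp add: pochhammer_of_real[symmetric])
  ultimately have "?d \<noteq> 0" by simp
  then show "\<exists>c. c \<noteq> 0 \<and> (\<forall>s. mellin_poly_factor \<mu> \<epsilon> n s =
      c * meixner_pollaczek n ((\<mu> + real \<epsilon>) / 2 + 1/4) (\<i> * (1/4 - s / 2)) (pi / 2))"
    unfolding meixner_pollaczek_half_pi mellin_poly_factor_def
    by (intro exI[of _ "inverse ?d"] conjI allI nonzero_imp_inverse_nonzero cancel)
qed (rule meixner_pollaczek_half_pi)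

end
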